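(* Let $r\geq1$ and let $G$ be a finite Abelian group of rank $r$ and exponent $n$. Then $$\rho(G) \leq c_r \sum_{d \mid n} \frac{P^-(d)-1}{d}.$$
   Context: $G$ is written additively; writing $G\simeq C_{n_1}\oplus\cdots\oplus C_{n_r}$ with $1<n_1\mid\cdots\mid n_r$, $r$ is the rank and $n_r$ the exponent. A sequence over $G$ is a finite multiset of elements; subsequences are sub-multisets. The cross number is $\mathsf{k}(S)=\sum_{g\in S}1/\mathrm{ord}(g)$ (with multiplicity). A tiny zero-sum subsequence of $S$ is a non-empty subsequence whose elements sum to $0$ and whose cross number is at most $1$. $\rho(G)=\max\{\mathsf{k}(S): S \text{ a sequence over } G \text{ containing no tiny zero-sum subsequence}\}$. $\eta(H)$ is the smallest positive integer $t$ such that every sequence over $H$ of length at least $t$ contains a non-empty zero-sum subsequence of length at most $\exp(H)$. For $r\geq1$, $c_r$ denotes the smallest real constant $c>0$ such that $\eta(C_m^r)\leq c(m-1)+1$ for every integer $m\geq1$ (it exists by a theorem of Alon and Dubiner). $P^-(d)$ is the smallest prime divisor of $d$, with $P^-(1)=1$. *)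

theory Defs
  imports
    "HOL-Algebra.Algebra"
    "HOL-Library.Multiset"
    "HOL-Library.Extended_Real"
    "HOL-Computational_Algebra.Primes"
begin

text \<open>
  Abelian groups are the (multiplicatively written) commutative groups of HOL-Algebra, so the
  additive sum of a sequence becomes a product and zero becomes \<^term>\<open>\<one>\<^bsub>G\<^esub>\<close>.
\<close>

definition cyclic_sum :: "nat list \<Rightarrow> (nat \<Rightarrow> int) monoid" where
  "cyclic_sum ns = product_group {..<length ns} (\<lambda>i. integer_mod_group (ns ! i))"

definition invariant_factors :: "('a, 'b) monoid_scheme \<Rightarrow> nat list \<Rightarrow> bool" where
  "invariant_factors G ns \<longleftrightarrow>
     (\<forall>n\<in>set ns. 1 < n) \<and>
     (\<forall>i. Suc i < length ns \<longrightarrow> ns ! i dvd ns ! Suc i) \<and>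
     G \<cong> cyclic_sum ns"

definition grp_exponent :: "('a, 'b) monoid_scheme \<Rightarrow> nat" where
  "grp_exponent G = (LEAST e. 0 < e \<and> (\<forall>x\<in>carrier G. x [^]\<^bsub>G\<^esub> e = \<one>\<^bsub>G\<^esub>))"

definition seq_over :: "('a, 'b) monoid_scheme \<Rightarrow> 'a multiset \<Rightarrow> bool" where
  "seq_over G S \<longleftrightarrow> set_mset S \<subseteq> carrier G"

definition seq_sum :: "('a, 'b) monoid_scheme \<Rightarrow> 'a multiset \<Rightarrow> 'a" where
  "seq_sum G S = (\<Otimes>\<^bsub>G\<^esub>g\<in>set_mset S. g [^]\<^bsub>G\<^esub> count S g)"

definition zero_sum :: "('a, 'b) monoid_scheme \<Rightarrow> 'a multiset \<Rightarrow> bool" where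
  "zero_sum G S \<longleftrightarrow> seq_sum G S = \<one>\<^bsub>G\<^esub>"

definition cross_number :: "('a, 'b) monoid_scheme \<Rightarrow> 'a multiset \<Rightarrow> real" where
  "cross_number G S = (\<Sum>g\<in>#S. 1 / real (group.ord G g))"

definition tiny_zero_sum :: "('a, 'b) monoid_scheme \<Rightarrow> 'a multiset \<Rightarrow> bool" where
  "tiny_zero_sum G T \<longleftrightarrow> T \<noteq> {#} \<and> zero_sum G T \<and> cross_number G T \<le> 1"

definition tiny_free :: "('a, 'b) monoid_scheme \<Rightarrow> 'a multiset set" where
  "tiny_free G = {S. seq_over G S \<and> \<not> (\<exists>T. T \<subseteq># S \<and> tiny_zero_sum G T)}"

definition rho :: "('a, 'b) monoid_scheme \<Rightarrow> real" where
  "rho G = Max (cross_number G ` tiny_free G)"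

definition eta_bound :: "('a, 'b) monoid_scheme \<Rightarrow> nat \<Rightarrow> bool" where
  "eta_bound H t \<longleftrightarrow>
     (\<forall>S. seq_over H S \<and> t \<le> size S \<longrightarrow>
        (\<exists>T. T \<subseteq># S \<and> T \<noteq> {#} \<and> zero_sum H T \<and> size T \<le> grp_exponent H))"

definition eta :: "('a, 'b) monoid_scheme \<Rightarrow> nat" where
  "eta H = (LEAST t. 0 < t \<and> eta_bound H t)"

definition eta_constants :: "nat \<Rightarrow> real set" where
  "eta_constants r =
     {c. 0 < c \<and> (\<forall>m\<ge>1. real (eta (cyclic_sum (replicate r m))) \<le> c * (real m - 1) + 1)}"

text \<open>
  The constant \<open>c\<^sub>r\<close> is the least element of \<^term>\<open>eta_constants r\<close>. That this set is non-empty
  is a theorem of Alon and Dubiner; to define \<open>c\<^sub>r\<close> without presupposing it, the infimum is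
  taken in the extended reals. Lemma \<open>c_const_least\<close> below shows that, as soon as the set is non-empty,
  the infimum is a real number and is its least element.
\<close>

definition c_const :: "nat \<Rightarrow> ereal" where
  "c_const r = (INF c\<in>eta_constants r. ereal c)"

definition P_minus :: "nat \<Rightarrow> nat" where
  "P_minus d = (if d = 1 then 1 else Min (prime_factors d))"

subsection \<open>The definitions are meaningful\<close>

lemma grp_exponent_works:
  fixes G (structure)
  assumes "group G" "finite (carrier G)"
  shows "0 < grp_exponent G" "\<And>x. x \<in> carrier G \<Longrightarrow> x [^]\<^bsub>G\<^esub> grp_exponent G = \<one>\<^bsub>G\<^esub>"
proof -
  interpret group G by fact
  have "0 < order G \<and> (\<forall>x\<in>carrier G. x [^] order G = \<one>)"
    using assms(2) by (auto simp: pow_order_eq_1 order_gt_0_iff_finite)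
  then have "0 < grp_exponent G \<and> (\<forall>x\<in>carrier G. x [^] grp_exponent G = \<one>)"
    unfolding grp_exponent_def by (rule LeastI)
  then show "0 < grp_exponent G" "\<And>x. x \<in> carrier G \<Longrightarrow> x [^] grp_exponent G = \<one>"
    by auto
qed

lemma comm_group_cyclic_sum: "comm_group (cyclic_sum ns)"
proof -
  have "group (cyclic_sum ns)"
    unfolding cyclic_sum_def by (rule product_group) simp
  then show ?thesis
    by (rule group.group_comm_groupI) (auto simp: cyclic_sum_def add.commute)
qed

lemma pow_cyclic_sum:
  assumes "x \<in> carrier (cyclic_sum ns)"
  shows "x [^]\<^bsub>cyclic_sum ns\<^esub> (k::nat) = (\<lambda>i\<in>{..<length ns}. (int k * x i) mod int (ns ! i))"
proof (induction k)
  case 0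
  show ?case by (simp add: cyclic_sum_def)
next
  case (Suc k)
  then show ?case
    by (auto simp: cyclic_sum_def fun_eq_iff mod_simps algebra_simps)
qed

lemma finite_cyclic_sum:
  assumes "\<And>n. n \<in> set ns \<Longrightarrow> 0 < n"
  shows "finite (carrier (cyclic_sum ns))"
  unfolding cyclic_sum_def carrier_product_group
  by (rule finite_PiE) (use assms nth_mem in \<open>fastforce simp: carrier_integer_mod_group\<close>)+

lemma grp_exponent_iso:
  assumes "group G" "group H" "G \<cong> H"
  shows "grp_exponent G = grp_exponent H"
proof -
  obtain h where h: "h \<in> iso G H" using assms(3) by (auto simp: is_iso_def)
  interpret group_hom G H h
    using assms h by (auto simp: group_hom_def group_hom_axioms_def iso_def)
  have inj: "inj_on h (carrier G)" and im: "h ` carrier G = carrier H"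
    using h by (auto simp: iso_def bij_betw_def)
  have *: "x [^]\<^bsub>G\<^esub> e = \<one>\<^bsub>G\<^esub> \<longleftrightarrow> h x [^]\<^bsub>H\<^esub> e = \<one>\<^bsub>H\<^esub>" if "x \<in> carrier G" for x and e :: nat
  proof -
    have "x [^]\<^bsub>G\<^esub> e = \<one>\<^bsub>G\<^esub> \<longleftrightarrow> h (x [^]\<^bsub>G\<^esub> e) = h \<one>\<^bsub>G\<^esub>"
      by (rule inj_on_eq_iff[OF inj, symmetric]) (use that in auto)
    then show ?thesis using that by (simp add: hom_nat_pow)
  qed
  have "(\<forall>x\<in>carrier G. x [^]\<^bsub>G\<^esub> e = \<one>\<^bsub>G\<^esub>) \<longleftrightarrow> (\<forall>x\<in>carrier H. x [^]\<^bsub>H\<^esub> e = \<one>\<^bsub>H\<^esub>)" for e :: nat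
    unfolding im[symmetric] by (simp add: *)
  then show ?thesis unfolding grp_exponent_def by simp
qed

lemma grp_exponent_cyclic_sum:
  assumes ne: "ns \<noteq> []" and pos: "\<And>n. n \<in> set ns \<Longrightarrow> 0 < n"
    and dvd: "\<And>n. n \<in> set ns \<Longrightarrow> n dvd last ns"
  shows "grp_exponent (cyclic_sum ns) = last ns"
  unfolding grp_exponent_def
proof (rule Least_equality)
  let ?G = "cyclic_sum ns"
  have "(int (last ns) * x i) mod int (ns ! i) = 0" if "i < length ns" for x i
    using dvd[of "ns ! i"] that by simp
  then have "x [^]\<^bsub>?G\<^esub> last ns = \<one>\<^bsub>?G\<^esub>" if "x \<in> carrier ?G" for x
    unfolding pow_cyclic_sum[OF that] by (auto simp: cyclic_sum_def fun_eq_iff)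
  then show "0 < last ns \<and> (\<forall>x\<in>carrier ?G. x [^]\<^bsub>?G\<^esub> last ns = \<one>\<^bsub>?G\<^esub>)"
    using pos ne by auto
next
  fix e :: nat assume e: "0 < e \<and> (\<forall>x\<in>carrier (cyclic_sum ns).
    x [^]\<^bsub>cyclic_sum ns\<^esub> e = \<one>\<^bsub>cyclic_sum ns\<^esub>)"
  define x :: "nat \<Rightarrow> int" where "x = (\<lambda>i\<in>{..<length ns}. 1 mod int (ns ! i))"
  have x: "x \<in> carrier (cyclic_sum ns)"
    using pos nth_mem by (fastforce simp: x_def cyclic_sum_def carrier_integer_mod_group)
  let ?l = "length ns - 1"
  have l: "?l < length ns" using ne by simp
  have "(x [^]\<^bsub>cyclic_sum ns\<^esub> e) ?l = \<one>\<^bsub>cyclic_sum ns\<^esub> ?l"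
    using e x by simp
  then have "int e mod int (ns ! ?l) = 0"
    using l unfolding pow_cyclic_sum[OF x] by (simp add: cyclic_sum_def x_def mod_mult_right_eq)
  then have "last ns dvd e"
    using ne by (auto simp: last_conv_nth)
  then show "last ns \<le> e" using e by (auto dest: dvd_imp_le)
qed

lemma invariant_factors_dvd_last:
  assumes "invariant_factors G ns" "n \<in> set ns"
  shows "n dvd last ns"
proof -
  obtain i where i: "i < length ns" "n = ns ! i" using assms(2) by (auto simp: in_set_conv_nth)
  have "j < length ns \<Longrightarrow> i \<le> j \<Longrightarrow> ns ! i dvd ns ! j" for j
  proof (induction j)
    case (Suc j)
    then show ?case
      using assms(1) by (cases "i = Suc j") (auto simp: invariant_factors_def intro: dvd_trans)
  qed simp
  then have "ns ! i dvd ns ! (length ns - 1)" using i(1) by auto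
  then show ?thesis using i by (metis last_conv_nth length_0_conv not_less_zero)
qed

lemma grp_exponent_invariant_factors:
  assumes "group G" "invariant_factors G ns" "ns \<noteq> []"
  shows "grp_exponent G = last ns"
proof -
  have "grp_exponent G = grp_exponent (cyclic_sum ns)"
    using assms comm_group.axioms(2)[OF comm_group_cyclic_sum]
    by (intro grp_exponent_iso) (auto simp: invariant_factors_def)
  also have "\<dots> = last ns"
    using assms invariant_factors_dvd_last[OF assms(2)]
    by (intro grp_exponent_cyclic_sum) (auto simp: invariant_factors_def)
  finally show ?thesis .
qed

lemma grp_exponent_homocyclic:
  assumes "1 \<le> r" "1 \<le> m"
  shows "grp_exponent (cyclic_sum (replicate r m)) = m"
  using assms grp_exponent_cyclic_sum[of "replicate r m"] by (auto simp: last_replicate)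

lemma seq_sum_replicate:
  assumes "comm_group G" "g \<in> carrier G"
  shows "seq_sum G (replicate_mset k g) = g [^]\<^bsub>G\<^esub> k"
proof -
  interpret comm_group G by fact
  show ?thesis
    using assms(2) by (cases "k = 0") (auto simp: seq_sum_def)
qed

lemma finite_submultisets: "finite {S. S \<subseteq># B}"
proof (induction B)
  case (add x B)
  have "S \<in> {S. S \<subseteq># B} \<union> add_mset x ` {S. S \<subseteq># B}" if "S \<subseteq># add_mset x B" for S
  proof (cases "x \<in># S")
    case True
    then obtain T where "S = add_mset x T" by (auto dest: multi_member_split)
    then show ?thesis using that by auto
  next
    case False
    then show ?thesis using that by (auto simp: subseteq_mset_def not_in_iff split: if_splits)
      (metis le0)
  qed
  then have "{S. S \<subseteq># add_mset x B} \<subseteq> {S. S \<subseteq># B} \<union> add_mset x ` {S. S \<subseteq># B}" by blast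
  then show ?case using add by (rule finite_subset[OF _ finite_UnI]) (simp add: add)
qed simp

lemma finite_tiny_free:
  assumes "comm_group G" "finite (carrier G)"
  shows "finite (tiny_free G)"
proof -
  interpret comm_group G by fact
  define B where "B = (\<Sum>g\<in>carrier G. replicate_mset (ord g) g)"
  have cB: "count B g = ord g" if "g \<in> carrier G" for g
    using assms(2) that by (simp add: B_def count_sum)
  have "S \<subseteq># B" if S: "S \<in> tiny_free G" for S
  proof (rule mset_subset_eqI)
    fix g
    show "count S g \<le> count B g"
    proof (cases "g \<in> carrier G")
      case True
      let ?T = "replicate_mset (ord g) g"
      have ord: "0 < ord g" using ord_ge_1[OF assms(2) True] by simp
      have "tiny_zero_sum G ?T"
        using ord True assms(1)
        by (auto simp: tiny_zero_sum_def zero_sum_def seq_sum_replicate cross_number_def)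
      then have "\<not> ?T \<subseteq># S" using S by (auto simp: tiny_free_def)
      then show ?thesis
        using True by (simp add: cB flip: count_le_replicate_mset_subset_eq)
    next
      case False
      then have "g \<notin># S" using S by (auto simp: tiny_free_def seq_over_def)
      then show ?thesis by (simp add: not_in_iff)
    qed
  qed
  then have "tiny_free G \<subseteq> {S. S \<subseteq># B}" by auto
  then show ?thesis by (rule finite_subset) (rule finite_submultisets)
qed

lemma rho_is_max:
  assumes "comm_group G" "finite (carrier G)"
  shows "rho G \<in> cross_number G ` tiny_free G"
    and "\<And>S. S \<in> tiny_free G \<Longrightarrow> cross_number G S \<le> rho G"
proof -
  have "{#} \<in> tiny_free G" by (auto simp: tiny_free_def seq_over_def tiny_zero_sum_def)
  then show "rho G \<in> cross_number G ` tiny_free G"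
    unfolding rho_def using finite_tiny_free[OF assms] by (intro Max_in) auto
  show "cross_number G S \<le> rho G" if "S \<in> tiny_free G" for S
    unfolding rho_def using finite_tiny_free[OF assms] that by (intro Max_ge) auto
qed

lemma eta_works:
  assumes "comm_group H" "finite (carrier H)"
  shows "0 < eta H" "eta_bound H (eta H)"
proof -
  interpret comm_group H by fact
  let ?e = "grp_exponent H"
  note e = grp_exponent_works[OF is_group assms(2)]
  let ?t = "Suc (card (carrier H) * ?e)"
  have "eta_bound H ?t"
    unfolding eta_bound_def
  proof (intro allI impI)
    fix S assume S: "seq_over H S \<and> ?t \<le> size S"
    have "\<exists>g\<in>carrier H. ?e \<le> count S g"
    proof (rule ccontr)
      assume "\<not> ?thesis"
      then have "size S \<le> (\<Sum>g\<in>set_mset S. ?e)"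
        using S unfolding size_multiset_overloaded_eq
        by (intro sum_mono) (metis le_cases seq_over_def subsetD)
      also have "\<dots> \<le> card (carrier H) * ?e"
        using S card_mono[OF assms(2)] by (simp add: seq_over_def)
      finally show False using S by simp
    qed
    then obtain g where g: "g \<in> carrier H" "?e \<le> count S g" by auto
    then show "\<exists>T. T \<subseteq># S \<and> T \<noteq> {#} \<and> zero_sum H T \<and> size T \<le> ?e"
      using e assms(1)
      by (intro exI[of _ "replicate_mset ?e g"])
        (auto simp: zero_sum_def seq_sum_replicate simp flip: count_le_replicate_mset_subset_eq)
  qed
  then have "0 < eta H \<and> eta_bound H (eta H)"
    unfolding eta_def using LeastI[of "\<lambda>t. 0 < t \<and> eta_bound H t" ?t] by simp
  then show "0 < eta H" "eta_bound H (eta H)" by auto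
qed

lemma eta_constants_ge_1:
  assumes "1 \<le> r" "c \<in> eta_constants r"
  shows "1 \<le> c"
proof -
  let ?H = "cyclic_sum (replicate r 2)"
  interpret H: comm_group ?H by (rule comm_group_cyclic_sum)
  have fin: "finite (carrier ?H)" by (rule finite_cyclic_sum) simp
  define x :: "nat \<Rightarrow> int" where "x = (\<lambda>i\<in>{..<r}. 1)"
  have x: "x \<in> carrier ?H" by (auto simp: x_def cyclic_sum_def carrier_integer_mod_group)
  have "x \<noteq> \<one>\<^bsub>?H\<^esub>"
    using assms(1) by (auto simp: x_def cyclic_sum_def fun_eq_iff intro!: exI[of _ 0])
  then have "\<not> zero_sum ?H {#x#}"
    using seq_sum_replicate[OF comm_group_cyclic_sum x, of 1] x by (simp add: zero_sum_def)
  then have "\<not> eta_bound ?H 1"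
    using x unfolding eta_bound_def
    by (auto simp: seq_over_def intro!: exI[of _ "{#x#}"] dest: nonempty_subseteq_mset_eq_single)
  then have "eta ?H \<noteq> 1" using eta_works(2)[OF comm_group_cyclic_sum fin] by auto
  then have "2 \<le> eta ?H" using eta_works(1)[OF comm_group_cyclic_sum fin] by simp
  moreover have "real (eta ?H) \<le> c * (real 2 - 1) + 1"
    using assms(2) unfolding eta_constants_def by (auto dest: spec[of _ 2])
  ultimately show ?thesis by simp
qed

lemma c_const_least:
  assumes "1 \<le> r" "eta_constants r \<noteq> {}"
  shows "\<exists>c. c_const r = ereal c \<and> c \<in> eta_constants r \<and> (\<forall>c'\<in>eta_constants r. c \<le> c')"
proof -
  let ?A = "eta_constants r"
  have bdd: "bdd_below ?A" using eta_constants_ge_1[OF assms(1)] by (rule bdd_belowI)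
  have least: "Inf ?A \<le> c" if "c \<in> ?A" for c using that bdd by (rule cInf_lower)
  have ge1: "1 \<le> Inf ?A" using assms eta_constants_ge_1 by (intro cInf_greatest) auto
  have "real (eta (cyclic_sum (replicate r m))) \<le> Inf ?A * (real m - 1) + 1" if "1 \<le> m" for m
  proof (cases "m = 1")
    case True
    then show ?thesis using assms(2) by (auto simp: eta_constants_def dest: spec[of _ 1])
  next
    case False
    then have m: "0 < real m - 1" using that by simp
    have "(real (eta (cyclic_sum (replicate r m))) - 1) / (real m - 1) \<le> Inf ?A"
      using assms(2) m that
      by (intro cInf_greatest) (auto simp: eta_constants_def divide_le_eq algebra_simps)
    then show ?thesis using m by (simp add: divide_le_eq)
  qed
  then have mem: "Inf ?A \<in> ?A" using ge1 by (auto simp: eta_constants_def)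
  then have "c_const r = ereal (Inf ?A)"
    unfolding c_const_def using least by (intro antisym INF_lower INF_greatest) auto
  then show ?thesis using mem least by blast
qed

end

theory Submission
  imports Defs
begin

text \<open>
  Let \<open>d > 1\<close> divide the exponent and let \<open>p = P\<^sup>-(d)\<close>. The \<open>d\<close>-torsion of \<open>G\<close> modulo its
  \<open>d/p\<close>-torsion embeds into \<open>C\<^sub>p\<^sup>r\<close>. So, among \<open>\<eta>(C\<^sub>p\<^sup>r)\<close> elements of order \<open>d\<close> there are at most
  \<open>p\<close> elements, forming a non-empty subsequence \<open>T\<close>, whose sum \<open>s\<close> has order dividing \<open>d/p\<close>. Then
  \<open>k(T) \<le> p/d \<le> 1/ord(s)\<close>, hence replacing \<open>T\<close> by \<open>s\<close> does not decrease the cross number and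
  creates no tiny zero-sum subsequence, while the sequence gets shorter. Once no replacement is
  possible, at most \<open>\<eta>(C\<^sub>p\<^sup>r) - 1 \<le> c\<^sub>r (p - 1)\<close> elements have order \<open>d\<close>, for each \<open>d\<close>.
\<close>

section \<open>Sums of sequences under concatenation and homomorphisms\<close>

lemma (in comm_group) seq_sum_empty [simp]: "seq_sum G {#} = \<one>"
  by (simp add: seq_sum_def)

text \<open>\<open>seq_sum\<close> is a product over the distinct terms, so adding \<open>a\<close>
  changes only the factor at \<open>a\<close>. That factor is split off on both sides; in
  \<open>T\<close> it is the power with exponent 0 when \<open>a\<close> does not occur
  there.\<close>

lemma (in comm_group) seq_sum_add_mset:
  assumes "a \<in> carrier G" "seq_over G T"
  shows "seq_sum G (add_mset a T) = a \<otimes> seq_sum G T"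
proof -
  have sub: "x \<in> carrier G" if "x \<in># T" for x
    using that assms by (auto simp: seq_over_def)
  let ?A = "set_mset T - {a}"
  have rest: "(\<Otimes>g\<in>?A. g [^] count (add_mset a T) g) = (\<Otimes>g\<in>?A. g [^] count T g)"
    by (rule finprod_cong') (use sub in auto)
  have closed: "(\<Otimes>g\<in>?A. g [^] count T g) \<in> carrier G"
    by (rule finprod_closed) (use sub in auto)
  have "seq_sum G (add_mset a T) = (\<Otimes>g\<in>insert a ?A. g [^] count (add_mset a T) g)"
    by (simp add: seq_sum_def)
  also have "\<dots> = a [^] Suc (count T a) \<otimes> (\<Otimes>g\<in>?A. g [^] count (add_mset a T) g)"
    by (subst finprod_insert) (use sub assms in auto)
  finally have l: "seq_sum G (add_mset a T) = a [^] Suc (count T a) \<otimes> (\<Otimes>g\<in>?A. g [^] count T g)"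
    by (simp only: rest)
  have r: "seq_sum G T = a [^] count T a \<otimes> (\<Otimes>g\<in>?A. g [^] count T g)"
  proof (cases "a \<in># T")
    case True
    then have "seq_sum G T = (\<Otimes>g\<in>insert a ?A. g [^] count T g)"
      by (simp add: seq_sum_def insert_absorb)
    also have "\<dots> = a [^] count T a \<otimes> (\<Otimes>g\<in>?A. g [^] count T g)"
      by (subst finprod_insert) (use sub assms in auto)
    finally show ?thesis .
  next
    case False
    then have "set_mset T - {a} = set_mset T" by auto
    then show ?thesis using False closed by (simp add: seq_sum_def not_in_iff)
  qed
  have "a [^] Suc (count T a) = a \<otimes> a [^] count T a"
    using assms(1) by (rule nat_pow_Suc2)
  then show ?thesis
    unfolding l r using assms(1) closed by (simp add: m_assoc del: nat_pow_Suc)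
qed

lemma (in comm_group) seq_sum_closed:
  "seq_over G T \<Longrightarrow> seq_sum G T \<in> carrier G"
  unfolding seq_sum_def seq_over_def by (rule finprod_closed) auto

lemma (in comm_group) seq_sum_plus:
  assumes "seq_over G S" "seq_over G T"
  shows "seq_sum G (S + T) = seq_sum G S \<otimes> seq_sum G T"
  using assms(1)
proof (induction S)
  case empty
  show ?case using seq_sum_closed[OF assms(2)] by simp
next
  case (add a S)
  then have "a \<in> carrier G" "seq_over G S" "seq_over G (S + T)"
    using assms(2) by (auto simp: seq_over_def)
  then show ?case
    using add.IH assms(2) by (simp add: seq_sum_add_mset seq_sum_closed m_assoc)
qed

text \<open>\<open>\<phi>\<close> is multiplicative on \<open>K\<close> only, so the induction has
  to carry membership of the sum in \<open>K\<close> along with the equation. It serves to move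
  zero-sum questions from a torsion subgroup to \<open>C_p^r\<close>.\<close>

lemma seq_sum_image_mset:
  fixes G (structure)
  assumes "comm_group G" "comm_group H" "subgroup K G"
    and \<phi>: "\<phi> \<in> hom (G\<lparr>carrier := K\<rparr>) H" and "set_mset T \<subseteq> K"
  shows "seq_sum G T \<in> K \<and> seq_sum H (image_mset \<phi> T) = \<phi> (seq_sum G T)"
  using assms(5)
proof (induction T)
  interpret G: comm_group G by fact
  interpret H: comm_group H by fact
  interpret K: subgroup K G by fact
  case empty
  interpret gh: group_hom "G\<lparr>carrier := K\<rparr>" H \<phi>
    using \<phi> G.subgroup_imp_group[OF assms(3)] H.is_group
    by (simp add: group_hom_def group_hom_axioms_def)
  show ?case using gh.hom_one by simp
next
  interpret G: comm_group G by fact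
  interpret H: comm_group H by fact
  interpret K: subgroup K G by fact
  case (add a T)
  then have a: "a \<in> K" and T: "set_mset T \<subseteq> K" by auto
  have ST: "seq_over G T" "seq_over H (image_mset \<phi> T)" "\<phi> a \<in> carrier H"
    using a T \<phi> K.subset by (auto simp: seq_over_def hom_def)
  have m: "\<phi> (x \<otimes> y) = \<phi> x \<otimes>\<^bsub>H\<^esub> \<phi> y" if "x \<in> K" "y \<in> K" for x y
    using \<phi> that by (auto simp: hom_def)
  show ?case
    using add.IH[OF T] a ST
    by (simp add: G.seq_sum_add_mset H.seq_sum_add_mset K.mem_carrier m)
qed

section \<open>Torsion subgroups and their map to \<open>C_p^r\<close>\<close>

lemma (in comm_group) subgroup_torsion:
  "subgroup {x \<in> carrier G. x [^] (d::nat) = \<one>} G"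
  by unfold_locales (auto simp: nat_pow_distrib nat_pow_inv)

text \<open>For \<open>y\<close> killed by \<open>d\<close>, each \<open>ns ! i\<close> divides
  \<open>d * y i\<close>, so the quotient in \<open>\<psi>\<close> is exact before it is reduced
  modulo \<open>p\<close>. If the reduced quotient is 0, a factor \<open>p\<close> can be cancelled
  and \<open>ns ! i\<close> divides \<open>(d div p) * y i\<close>. Hence the kernel lies in the
  torsion of \<open>d div p\<close>, which makes the embedding of the quotient explicit.\<close>

lemma cyclic_sum_torsion_hom:
  fixes ns :: "nat list" and d p :: nat
  defines "C \<equiv> cyclic_sum ns"
  defines "\<psi> \<equiv> \<lambda>y. \<lambda>i\<in>{..<length ns}. (int d * y i div int (ns ! i)) mod int p"
  assumes pos: "\<And>n. n \<in> set ns \<Longrightarrow> 0 < n" and "0 < p" "p dvd d"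
  shows "\<psi> \<in> hom (C\<lparr>carrier := {x \<in> carrier C. x [^]\<^bsub>C\<^esub> d = \<one>\<^bsub>C\<^esub>}\<rparr>)
                 (cyclic_sum (replicate (length ns) p))"
    and "\<And>x. \<lbrakk>x \<in> carrier C; x [^]\<^bsub>C\<^esub> d = \<one>\<^bsub>C\<^esub>; \<psi> x = \<one>\<^bsub>cyclic_sum (replicate (length ns) p)\<^esub>\<rbrakk>
           \<Longrightarrow> x [^]\<^bsub>C\<^esub> (d div p) = \<one>\<^bsub>C\<^esub>"
proof -
  have tors: "x [^]\<^bsub>C\<^esub> k = \<one>\<^bsub>C\<^esub> \<longleftrightarrow> (\<forall>i<length ns. int (ns ! i) dvd int k * x i)"
    if "x \<in> carrier C" for x and k :: nat
    unfolding C_def pow_cyclic_sum[OF that[unfolded C_def]]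
    by (auto simp: cyclic_sum_def fun_eq_iff restrict_def dvd_eq_mod_eq_0)
  \<comment> \<open>Additivity in one coordinate: reducing \<open>y + z\<close> modulo
    \<open>n\<close> subtracts some \<open>n * q\<close>, which changes the quotient by
    \<open>d * q\<close>. This vanishes modulo \<open>p\<close> because \<open>p\<close> divides
    \<open>d\<close>.\<close>
  have add: "(int d * ((y + z) mod n) div n) mod int p
      = ((int d * y div n) mod int p + (int d * z div n) mod int p) mod int p"
    if n: "0 < n" "n dvd int d * y" "n dvd int d * z" for n y z :: int
  proof -
    obtain a b where ab: "int d * y = n * a" "int d * z = n * b" using n by (auto elim!: dvdE)
    obtain e where e: "int d = int p * e" using \<open>p dvd d\<close> by (metis dvdE of_nat_mult)
    define q where "q = (y + z) div n"
    have "(y + z) mod n = y + z - n * q"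
      by (simp add: q_def minus_mult_div_eq_mod)
    then have "int d * ((y + z) mod n) = int d * y + int d * z - n * (int d * q)"
      by (simp add: right_diff_distrib distrib_left mult.left_commute)
    also have "\<dots> = n * (a + b - int p * (e * q))"
      unfolding ab unfolding e by (simp only: algebra_simps)
    finally have "int d * ((y + z) mod n) div n = a + b - int p * (e * q)"
      using \<open>0 < n\<close> by simp
    moreover have "(a + b - int p * (e * q)) mod int p = (a mod int p + b mod int p) mod int p"
      unfolding mod_add_eq by (simp add: mod_eq_dvd_iff)
    ultimately show ?thesis
      using \<open>0 < n\<close> by (simp add: ab)
  qed
  show "\<psi> \<in> hom (C\<lparr>carrier := {x \<in> carrier C. x [^]\<^bsub>C\<^esub> d = \<one>\<^bsub>C\<^esub>}\<rparr>)
                (cyclic_sum (replicate (length ns) p))"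
  proof (rule homI)
    fix x y
    assume "x \<in> carrier (C\<lparr>carrier := {x \<in> carrier C. x [^]\<^bsub>C\<^esub> d = \<one>\<^bsub>C\<^esub>}\<rparr>)"
      and "y \<in> carrier (C\<lparr>carrier := {x \<in> carrier C. x [^]\<^bsub>C\<^esub> d = \<one>\<^bsub>C\<^esub>}\<rparr>)"
    then have "\<forall>i<length ns. int (ns ! i) dvd int d * x i" "\<forall>i<length ns. int (ns ! i) dvd int d * y i"
      by (auto simp: tors)
    then show "\<psi> (x \<otimes>\<^bsub>C\<lparr>carrier := {x \<in> carrier C. x [^]\<^bsub>C\<^esub> d = \<one>\<^bsub>C\<^esub>}\<rparr>\<^esub> y)
        = \<psi> x \<otimes>\<^bsub>cyclic_sum (replicate (length ns) p)\<^esub> \<psi> y"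
      by (auto simp: \<psi>_def C_def cyclic_sum_def fun_eq_iff pos intro!: add)
  qed (use \<open>0 < p\<close> in \<open>auto simp: \<psi>_def cyclic_sum_def carrier_integer_mod_group\<close>)
  fix x
  assume x: "x \<in> carrier C" "x [^]\<^bsub>C\<^esub> d = \<one>\<^bsub>C\<^esub>" "\<psi> x = \<one>\<^bsub>cyclic_sum (replicate (length ns) p)\<^esub>"
  have "int (ns ! i) dvd int (d div p) * x i" if i: "i < length ns" for i
  proof -
    have "\<psi> x i = 0" using x(3) i by (simp add: cyclic_sum_def)
    then have "int p dvd int d * x i div int (ns ! i)"
      using i by (simp add: \<psi>_def dvd_eq_mod_eq_0)
    moreover have "int (ns ! i) dvd int d * x i" using x tors i by auto
    ultimately obtain k where "int d * x i = int (ns ! i) * (int p * k)"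
      by (metis dvd_def dvd_mult_div_cancel)
    moreover have "int d = int p * int (d div p)"
      using \<open>p dvd d\<close> by (metis dvd_mult_div_cancel of_nat_mult)
    ultimately have "int p * (int (d div p) * x i) = int p * (int (ns ! i) * k)"
      by (simp add: algebra_simps)
    then show ?thesis using \<open>0 < p\<close> by simp
  qed
  then show "x [^]\<^bsub>C\<^esub> (d div p) = \<one>\<^bsub>C\<^esub>" using x(1) by (simp add: tors)
qed

text \<open>The terms of \<open>S\<close> are mapped into \<open>C_p^r\<close>, where the definition
  of \<open>eta\<close> yields a short zero-sum subsequence of the images. Its preimage
  \<open>T\<close> has a sum in the kernel of the map, hence in the smaller torsion
  subgroup.\<close>

lemma short_subsequence_in_smaller_torsion:
  fixes G (structure)
  assumes "comm_group G" "G \<cong> cyclic_sum ns" "\<And>n. n \<in> set ns \<Longrightarrow> 0 < n" "ns \<noteq> []"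
    and "0 < p" "p dvd d"
    and S: "\<And>x. x \<in># S \<Longrightarrow> x \<in> carrier G \<and> x [^] d = \<one>"
    and size: "eta (cyclic_sum (replicate (length ns) p)) \<le> size S"
  shows "\<exists>T. T \<subseteq># S \<and> T \<noteq> {#} \<and> size T \<le> p \<and> seq_sum G T [^] (d div p) = \<one>"
proof -
  interpret G: comm_group G by fact
  define C where "C = cyclic_sum ns"
  define H where "H = cyclic_sum (replicate (length ns) p)"
  interpret C: comm_group C unfolding C_def by (rule comm_group_cyclic_sum)
  interpret H: comm_group H unfolding H_def by (rule comm_group_cyclic_sum)
  define K where "K = {x \<in> carrier G. x [^] d = \<one>}"
  define \<psi> where "\<psi> = (\<lambda>y. \<lambda>i\<in>{..<length ns}. (int d * y i div int (ns ! i)) mod int p)"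
  note \<psi> = cyclic_sum_torsion_hom[where ns = ns, OF assms(3,5,6), folded \<psi>_def C_def H_def]
  obtain h where h: "h \<in> iso G C" using assms(2) by (auto simp: is_iso_def C_def)
  interpret h: group_hom G C h
    using h by unfold_locales (auto simp: iso_def)
  have inj: "inj_on h (carrier G)" using h by (auto simp: iso_def bij_betw_def)
  \<comment> \<open>Torsion conditions pass both ways through \<open>h\<close>: forward to land in
    the domain of \<open>\<psi>\<close>, backward to return the kernel condition to
    \<open>G\<close>.\<close>
  have tors: "h x [^]\<^bsub>C\<^esub> k = \<one>\<^bsub>C\<^esub> \<longleftrightarrow> x [^] k = \<one>" if "x \<in> carrier G" for x and k :: nat
    using inj_on_eq_iff[OF inj, of "x [^] k" \<one>] that by (simp add: h.hom_nat_pow)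
  have hom: "\<psi> \<circ> h \<in> hom (G\<lparr>carrier := K\<rparr>) H"
    using \<psi>(1) by (auto simp: hom_def K_def tors Pi_iff)
  have sub: "subgroup K G" unfolding K_def by (rule G.subgroup_torsion)
  have fin: "finite (carrier H)"
    unfolding H_def by (rule finite_cyclic_sum) (use \<open>0 < p\<close> in auto)
  have SK: "set_mset S \<subseteq> K" using S by (auto simp: K_def)
  then have "seq_over H (image_mset (\<psi> \<circ> h) S)"
    using hom unfolding hom_def seq_over_def by auto
  \<comment> \<open>The exponent of \<open>H\<close> is the length bound in
    \<open>eta_bound\<close>, so this is where \<open>size T \<le> p\<close> comes from.\<close>
  moreover have "grp_exponent H = p"
    unfolding H_def using assms(4,5) by (intro grp_exponent_homocyclic) (auto simp: Suc_le_eq)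
  ultimately obtain T' where T': "T' \<subseteq># image_mset (\<psi> \<circ> h) S" "T' \<noteq> {#}" "zero_sum H T'" "size T' \<le> p"
    using eta_works(2)[OF H.comm_group_axioms fin] size unfolding eta_bound_def H_def by force
  \<comment> \<open>A subsequence of the image sequence is lifted, with multiplicities, to a
    subsequence of \<open>S\<close>.\<close>
  from T'(1) obtain U where "image_mset (\<psi> \<circ> h) S = T' + U"
    by (auto simp: mset_subset_eq_exists_conv)
  then obtain T U' where T: "S = T + U'" "T' = image_mset (\<psi> \<circ> h) T"
    by (metis image_mset_eq_plusD)
  have "seq_sum G T \<in> K \<and> seq_sum H (image_mset (\<psi> \<circ> h) T) = (\<psi> \<circ> h) (seq_sum G T)"
    by (rule seq_sum_image_mset[OF assms(1) H.comm_group_axioms sub hom]) (use SK T in auto)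
  then have "seq_sum G T \<in> carrier G" "seq_sum G T [^] d = \<one>" "\<psi> (h (seq_sum G T)) = \<one>\<^bsub>H\<^esub>"
    using T T'(3) by (auto simp: K_def zero_sum_def)
  then have "seq_sum G T [^] (d div p) = \<one>"
    using \<psi>(2)[of "h (seq_sum G T)"] by (simp add: tors \<psi>_def)
  then show ?thesis using T T' by (intro exI[of _ T]) auto
qed

section \<open>Cross numbers and the replacement of a subsequence by its sum\<close>

lemma cross_number_add:
  "cross_number G (S + T) = cross_number G S + cross_number G T"
  by (simp add: cross_number_def)

text \<open>Terms are grouped by order, so that bounds on the number of terms of each order turn
  into a bound on the cross number.\<close>

lemma cross_number_eq_sum_orders:
  assumes "finite D" "\<And>g. g \<in># S \<Longrightarrow> group.ord G g \<in> D"
  shows "cross_number G S = (\<Sum>d\<in>D. real (size {#g \<in># S. group.ord G g = d#}) / real d)"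
  using assms(2)
proof (induction S)
  case empty
  show ?case by (simp add: cross_number_def)
next
  case (add a S)
  have "(\<Sum>d\<in>D. real (size {#g \<in># add_mset a S. group.ord G g = d#}) / real d)
      = (\<Sum>d\<in>D. real (size {#g \<in># S. group.ord G g = d#}) / real d
               + (if d = group.ord G a then 1 / real d else 0))"
    by (rule sum.cong) (auto simp: add_divide_distrib)
  also have "\<dots> = cross_number G S + 1 / real (group.ord G a)"
    using add assms(1) by (simp add: sum.distrib sum.delta)
  finally show ?case by (simp add: cross_number_def)
qed

text \<open>A tiny zero-sum subsequence that uses the new term can be expanded by putting
  \<open>T\<close> back in its place. The sum is unchanged and, by the assumed inequality, the cross
  number does not grow, so \<open>S\<close> would already contain a tiny zero-sum
  subsequence.\<close>

lemma tiny_free_replace: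
  fixes G (structure)
  assumes "comm_group G" and S: "S \<in> tiny_free G" and T: "T \<subseteq># S" "T \<noteq> {#}"
    and le: "cross_number G T \<le> 1 / real (group.ord G (seq_sum G T))"
  shows "add_mset (seq_sum G T) (S - T) \<in> tiny_free G"
proof -
  interpret comm_group G by fact
  let ?s = "seq_sum G T"
  have over: "seq_over G S" "seq_over G T" "seq_over G (S - T)"
    using S T by (auto simp: tiny_free_def seq_over_def dest: in_diffD mset_subset_eqD)
  have s: "?s \<in> carrier G" using over seq_sum_closed by auto
  have "\<not> tiny_zero_sum G U" if U: "U \<subseteq># add_mset ?s (S - T)" for U
  proof
    assume tiny: "tiny_zero_sum G U"
    show False
    proof (cases "U \<subseteq># S - T")
      case True
      then have "U \<subseteq># S" by (meson diff_subset_eq_self subset_mset.order_trans)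
      then show False using S tiny by (auto simp: tiny_free_def)
    next
      case False
      \<comment> \<open>Only the added copy of \<open>?s\<close> can take \<open>U\<close> outside
        \<open>S - T\<close>; removing one copy leaves \<open>V\<close> inside \<open>S - T\<close>,
        disjoint from \<open>T\<close> as a subsequence of \<open>S\<close>.\<close>
      then have "?s \<in># U"
        using U by (metis add_mset_remove_trivial diff_single_trivial subset_eq_diff_conv
            add_mset_add_single)
      then obtain V where V: "U = add_mset ?s V" by (auto dest: multi_member_split)
      then have VS: "V \<subseteq># S - T" using U by simp
      then have "T + V \<subseteq># T + (S - T)" by simp
      then have sub: "T + V \<subseteq># S" using T(1) by simp
      have "seq_over G V" using VS over(3) by (auto simp: seq_over_def dest: mset_subset_eqD)
      then have "seq_sum G (T + V) = seq_sum G U"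
        using over(2) s by (simp add: V seq_sum_plus seq_sum_add_mset)
      moreover have "cross_number G (T + V) \<le> cross_number G U"
        using le by (simp add: V cross_number_add) (simp add: cross_number_def)
      ultimately have "tiny_zero_sum G (T + V)"
        using tiny T(2) by (auto simp: tiny_zero_sum_def zero_sum_def)
      then show False using S sub by (auto simp: tiny_free_def)
    qed
  qed
  moreover have "seq_over G (add_mset ?s (S - T))"
    using over(3) s by (auto simp: seq_over_def)
  ultimately show ?thesis by (auto simp: tiny_free_def)
qed

text \<open>The replacement process, as an induction on the length. \<open>b d\<close> is the number
  of terms of order \<open>d\<close> that may remain: any more of them allow a replacement. In the
  application \<open>p\<close> is \<open>P_minus\<close> and \<open>b d\<close> is
  \<open>\<eta> d - 1\<close>.\<close>

lemma tiny_free_cross_number_le: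
  fixes G (structure) and n :: nat and p b :: "nat \<Rightarrow> nat"
  assumes "comm_group G" "finite (carrier G)" "0 < n" "\<And>x. x \<in> carrier G \<Longrightarrow> x [^] n = \<one>"
    and p: "\<And>d. \<lbrakk>d dvd n; d \<noteq> 1\<rbrakk> \<Longrightarrow> 1 < p d \<and> p d dvd d"
    and short: "\<And>d S. \<lbrakk>d dvd n; d \<noteq> 1; \<And>x. x \<in># S \<Longrightarrow> x \<in> carrier G \<and> x [^] d = \<one>; b d < size S\<rbrakk>
      \<Longrightarrow> \<exists>T. T \<subseteq># S \<and> T \<noteq> {#} \<and> size T \<le> p d \<and> seq_sum G T [^] (d div p d) = \<one>"
    and "S \<in> tiny_free G"
  shows "cross_number G S \<le> (\<Sum>d | d dvd n \<and> d \<noteq> 1. real (b d) / real d)"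
  using assms(7)
proof (induction "size S" arbitrary: S rule: less_induct)
  case less
  interpret comm_group G by fact
  have over: "x \<in> carrier G" if "x \<in># S" for x
    using less.prems that by (auto simp: tiny_free_def seq_over_def)
  \<comment> \<open>A term of order 1 is the identity, by itself a zero-sum sequence of cross number
    1 and hence tiny. So no term contributes to \<open>d = 1\<close>.\<close>
  have ord_S: "ord x dvd n \<and> ord x \<noteq> 1" if x: "x \<in># S" for x
  proof -
    have "\<not> tiny_zero_sum G {#x#}" using less.prems x by (auto simp: tiny_free_def)
    then have "\<not> (x = \<one> \<and> ord x = 1)"
      using over[OF x] seq_sum_add_mset[of x "{#}"]
      by (auto simp: tiny_zero_sum_def zero_sum_def cross_number_def seq_over_def)
    then have "ord x \<noteq> 1" using ord_eq_1[OF over[OF x]] by blast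
    then show ?thesis using over[OF x] assms(4) by (simp add: pow_eq_id)
  qed
  let ?S = "\<lambda>d. {#g \<in># S. ord g = d#}"
  show ?case
  proof (cases "\<exists>d. d dvd n \<and> d \<noteq> 1 \<and> b d < size (?S d)")
    case True
    then obtain d where d: "d dvd n" "d \<noteq> 1" "b d < size (?S d)" by blast
    have "x \<in> carrier G \<and> x [^] d = \<one>" if "x \<in># ?S d" for x
      using that over by (auto simp: pow_ord_eq_1)
    then obtain T where T: "T \<subseteq># ?S d" "T \<noteq> {#}" "size T \<le> p d" "seq_sum G T [^] (d div p d) = \<one>"
      using short[OF d(1,2) _ d(3)] by blast
    let ?s = "seq_sum G T"
    have TS: "T \<subseteq># S" using T(1) by (meson multiset_filter_subset subset_mset.order_trans)
    have ordT: "ord x = d" if "x \<in># T" for x using mset_subset_eqD[OF T(1) that] by simp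
    have s: "?s \<in> carrier G"
      by (rule seq_sum_closed) (use TS over in \<open>auto simp: seq_over_def dest: mset_subset_eqD\<close>)
    have pd: "1 < p d" "p d dvd d" using p[OF d(1,2)] by auto
    have d0: "0 < d" using d(1) \<open>0 < n\<close> by (auto intro: Nat.gr0I)
    then have dp: "0 < d div p d" using pd by (auto simp: div_greater_zero_iff intro: dvd_imp_le)
    have ord_s: "ord ?s dvd d div p d" using T(4) s by (simp add: pow_eq_id)
    have ord_pos: "0 < ord ?s" using ord_ge_1[OF assms(2) s] by simp
    have "cross_number G T = real (size T) / real d"
    proof -
      have "image_mset (\<lambda>g. 1 / real (ord g)) T = image_mset (\<lambda>g. 1 / real d) T"
        by (rule image_mset_cong) (simp add: ordT)
      then show ?thesis by (simp add: cross_number_def)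
    qed
    also have "\<dots> \<le> real (p d) / real d" using T(3) by (simp add: divide_right_mono)
    also have "\<dots> = 1 / real (d div p d)" using pd d0 by (simp add: real_of_nat_div)
    also have "\<dots> \<le> 1 / real (ord ?s)"
      using dvd_imp_le[OF ord_s dp] ord_pos by (simp add: frac_le)
    finally have le: "cross_number G T \<le> 1 / real (ord ?s)" .
    \<comment> \<open>Replacing a single term would not shorten the sequence. It cannot happen: the
      sum of a singleton has order \<open>d\<close>, which does not divide the smaller
      \<open>d div p d\<close>.\<close>
    have "size T \<noteq> 1"
    proof
      assume "size T = 1"
      then obtain x where x: "T = {#x#}" by (blast dest: size_1_singleton_mset)
      then have "x \<in> carrier G" using TS over by auto
      then have "?s = x" using x seq_sum_add_mset[of x "{#}"] by (simp add: seq_over_def)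
      then have "d dvd d div p d" using ord_s ordT x by simp
      then have "d \<le> d div p d" using dp by (rule dvd_imp_le)
      then show False using pd d0 by (metis div_less_dividend not_le)
    qed
    moreover have "size T \<noteq> 0" using T(2) by simp
    ultimately have "1 < size T" by linarith
    then have "size (add_mset ?s (S - T)) < size S"
      using TS size_mset_mono[OF TS] by (simp add: size_Diff_submset)
    then have "cross_number G (add_mset ?s (S - T)) \<le> (\<Sum>d | d dvd n \<and> d \<noteq> 1. real (b d) / real d)"
      using tiny_free_replace[OF assms(1) less.prems TS T(2) le] by (rule less.hyps)
    moreover have "cross_number G S \<le> cross_number G (add_mset ?s (S - T))"
    proof -
      have "cross_number G S = cross_number G T + cross_number G (S - T)"
        using TS by (simp flip: cross_number_add)
      then show ?thesis using le by (simp add: cross_number_def)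
    qed
    ultimately show ?thesis by linarith
  next
    case False
    \<comment> \<open>No order \<open>d\<close> occurs more than \<open>b d\<close> times, so
      counting by orders gives the bound.\<close>
    have "finite {d. d dvd n \<and> d \<noteq> 1}" using \<open>0 < n\<close> by simp
    then have "cross_number G S = (\<Sum>d | d dvd n \<and> d \<noteq> 1. real (size (?S d)) / real d)"
      by (rule cross_number_eq_sum_orders) (use ord_S in auto)
    also have "\<dots> \<le> (\<Sum>d | d dvd n \<and> d \<noteq> 1. real (b d) / real d)"
      using False by (intro sum_mono divide_right_mono) (auto simp: not_less)
    finally show ?thesis .
  qed
qed

section \<open>Smallest prime divisors and the final estimate\<close>

lemma P_minus_gt_1_dvd:
  assumes "0 < d" "d \<noteq> 1"
  shows "1 < P_minus d" "P_minus d dvd d"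
proof -
  have "prime_factors d \<noteq> {}" using assms by (auto simp: prime_factorization_empty_iff)
  then have "P_minus d \<in> prime_factors d" using assms by (simp add: P_minus_def)
  then show "1 < P_minus d" "P_minus d dvd d"
    by (auto simp: in_prime_factors_iff dest: prime_gt_1_nat)
qed

theorem theorem9:
  fixes G :: "('a, 'b) monoid_scheme" and r n :: nat and ns :: "nat list"
  assumes "comm_group G" and "finite (carrier G)"
    and "invariant_factors G ns"
    and "r \<ge> 1" and "length ns = r" and "last ns = n"
  shows "ereal (rho G) \<le> c_const r * ereal (\<Sum>d | d dvd n. (real (P_minus d) - 1) / real d)"
proof -
  interpret comm_group G by fact
  have ne: "ns \<noteq> []" using assms by auto
  have gt: "1 < m" if "m \<in> set ns" for m using assms(3) that by (auto simp: invariant_factors_def)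
  have n: "1 < n" using gt ne assms(6) by auto
  have exp: "grp_exponent G = n"
    using grp_exponent_invariant_factors[OF is_group assms(3) ne] assms(6) by simp
  let ?f = "\<lambda>d. (real (P_minus d) - 1) / real d"
  have P: "1 < P_minus d" "P_minus d dvd d" if "d dvd n" "d \<noteq> 1" for d
    using P_minus_gt_1_dvd[of d] dvd_pos_nat[of n d] that n by simp_all
  have f_pos: "0 < ?f d" if "d dvd n" "d \<noteq> 1" for d
    using P(1)[OF that] that n by (auto intro!: divide_pos_pos Nat.gr0I)
  \<comment> \<open>The summand at \<open>d = 1\<close> is 0 by the convention
    \<open>P_minus 1 = 1\<close>.\<close>
  have sum_eq: "(\<Sum>d | d dvd n. ?f d) = (\<Sum>d | d dvd n \<and> d \<noteq> 1. ?f d)"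
    using n by (intro sum.mono_neutral_right) (auto simp: P_minus_def)
  \<comment> \<open>Strict positivity, witnessed by \<open>d = n\<close>, keeps the right-hand side
    infinite when \<open>c_const r\<close> is: in the extended reals infinity times 0 would be
    0.\<close>
  have sum_pos: "0 < (\<Sum>d | d dvd n. ?f d)"
    unfolding sum_eq using n f_pos by (intro sum_pos) (auto intro: exI[of _ n])
  show ?thesis
  proof (cases "eta_constants r = {}")
    case True
    then have "c_const r = \<infinity>" by (simp add: c_const_def top_ereal_def)
    then show ?thesis using sum_pos by simp
  next
    case False
    then obtain c where c: "c_const r = ereal c" "c \<in> eta_constants r"
      using c_const_least[OF assms(4)] by blast
    define \<eta> where "\<eta> d = eta (cyclic_sum (replicate r (P_minus d)))" for d
    \<comment> \<open>Makes the subtraction of natural numbers in \<open>\<eta> d - 1\<close>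
      exact.\<close>
    have eta_pos: "0 < \<eta> d" if "d dvd n" "d \<noteq> 1" for d
      unfolding \<eta>_def
      by (rule eta_works(1)[OF comm_group_cyclic_sum finite_cyclic_sum])
        (use P(1)[OF that] in auto)
    have eta_le: "real (\<eta> d - 1) \<le> c * (real (P_minus d) - 1)" if "d dvd n" "d \<noteq> 1" for d
    proof -
      have "real (\<eta> d) \<le> c * (real (P_minus d) - 1) + 1"
        using c(2) P(1)[OF that] by (auto simp: eta_constants_def \<eta>_def)
      then show ?thesis using eta_pos[OF that] by linarith
    qed
    obtain S where S: "S \<in> tiny_free G" "rho G = cross_number G S"
      using rho_is_max(1)[OF assms(1,2)] by auto
    \<comment> \<open>Extraction needs \<open>\<eta> d\<close> terms, so at most
      \<open>\<eta> d - 1\<close> of order \<open>d\<close> remain. This 1 absorbs the summand 1 in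
      the bound defining \<open>eta_constants\<close>.\<close>
    have "cross_number G S \<le> (\<Sum>d | d dvd n \<and> d \<noteq> 1. real (\<eta> d - 1) / real d)"
    proof (rule tiny_free_cross_number_le[where p = P_minus, OF assms(1,2) _ _ _ _ S(1)])
      show "x [^]\<^bsub>G\<^esub> n = \<one>\<^bsub>G\<^esub>" if "x \<in> carrier G" for x
        using grp_exponent_works(2)[OF is_group assms(2) that] exp by simp
      show "1 < P_minus d \<and> P_minus d dvd d" if "d dvd n" "d \<noteq> 1" for d
        using P[OF that] by simp
      fix d U
      assume d: "d dvd n" "d \<noteq> 1" and U: "\<And>x. x \<in># U \<Longrightarrow> x \<in> carrier G \<and> x [^]\<^bsub>G\<^esub> d = \<one>\<^bsub>G\<^esub>"
        and size: "\<eta> d - 1 < size U"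
      show "\<exists>T. T \<subseteq># U \<and> T \<noteq> {#} \<and> size T \<le> P_minus d \<and> seq_sum G T [^]\<^bsub>G\<^esub> (d div P_minus d) = \<one>\<^bsub>G\<^esub>"
      proof (rule short_subsequence_in_smaller_torsion[OF assms(1) _ _ ne])
        show "G \<cong> cyclic_sum ns" using assms(3) by (simp add: invariant_factors_def)
        show "eta (cyclic_sum (replicate (length ns) (P_minus d))) \<le> size U"
          using size by (simp add: assms(5) \<eta>_def)
      qed (use P[OF d] U in \<open>auto dest: gt\<close>)
    qed (use n in simp)
    also have "\<dots> \<le> (\<Sum>d | d dvd n \<and> d \<noteq> 1. c * ?f d)"
      using eta_le by (intro sum_mono) (auto simp: divide_right_mono)
    also have "\<dots> = c * (\<Sum>d | d dvd n. ?f d)"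
      by (simp add: sum_eq sum_distrib_left)
    finally show ?thesis using S(2) c(1) by simp
  qed
qed

end
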